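(* Let $k \in \mathbb{N}$ and $\theta_k, \theta_{k+1} \in \Theta$. Let $\pi_{\theta_k}^f(x) = \frac{1}{Z_w} W_{\theta_k}^f(x)\, p_{\theta_k}(x)$, and suppose that $p_{\theta_{k+1}}$ satisfies, for some $\Delta_k \in \mathbb{R}$, $$KL(\pi_{\theta_k}^f, p_{\theta_{k+1}}) + \Delta_k \leq KL(\pi_{\theta_k}^f, p_{\theta_k}).$$ Then $J(\theta_{k+1} | \theta_k) \geq \exp(\Delta_k)\, J(\theta_k | \theta_k) = \exp(\Delta_k)\, Z_w$. In particular, if $\Delta_k > 0$, then $J(\theta_{k+1} | \theta_k) > J(\theta_k | \theta_k) = Z_w$.
   Context: Setting: $\mathbb{X}$ is a measurable space with a measure $m$, $f:\mathbb{X}\to\mathbb{R}$ is an objective function, and $\{p_\theta,\ \theta\in\Theta\}$ is a parametric family of probability distributions on $\mathbb{X}$, each having a density with respect to $m$, also denoted $p_\theta$. For $\theta\in\Theta$ and $x\in\mathbb{X}$, set $q_\theta^{<}(x) = \mathbb{P}_{X\sim p_\theta}[f(X)<f(x)]$ and $q_\theta^{\leq}(x) = \mathbb{P}_{X\sim p_\theta}[f(X)\leq f(x)]$. Weighting: $w:[0,1]\to\mathbb{R}_+$ is a non-increasing function and $Z_w=\int_0^1 w(u)\,du$ (assumed positive so that the target density below is defined). The preference function $W_\theta^f:\mathbb{X}\to\mathbb{R}$ is $W_\theta^f(x) = w(q_\theta^{\leq}(x))$ if $q_\theta^{\leq}(x)=q_\theta^{<}(x)$, and $W_\theta^f(x)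 = \frac{1}{q_\theta^{\leq}(x)-q_\theta^{<}(x)}\int_{q_\theta^{<}(x)}^{q_\theta^{\leq}(x)} w(u)\,du$ otherwise. Reformulated objective: $J(\theta|\theta') = \mathbb{E}_{X\sim p_\theta}[W_{\theta'}^f(X)]$ for $\theta,\theta'\in\Theta$. One has $J(\theta|\theta)=Z_w$ for every $\theta \in \Theta$, so that $\pi_\theta^f = \frac{1}{Z_w}W_\theta^f p_\theta$ is a probability density with respect to $m$. Divergence: for probability densities $p_1,p_2$ with respect to $m$, $KL(p_1,p_2)=\int \ln\left(\frac{p_1(x)}{p_2(x)}\right)p_1(x)\,m(dx)$, with the convention $\ln(p_1(x))p_1(x)=0$ when $p_1(x)=0$. *)

theory Defs
  imports "HOL-Probability.Probability"
begin

definition prob_density :: "'a measure \<Rightarrow> ('a \<Rightarrow> real) \<Rightarrow> bool" where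
  "prob_density M p \<longleftrightarrow>
     p \<in> borel_measurable M \<and> (\<forall>x\<in>space M. 0 \<le> p x) \<and>
     prob_space (density M (\<lambda>x. ennreal (p x)))"

definition distr_of :: "'a measure \<Rightarrow> ('t \<Rightarrow> 'a \<Rightarrow> real) \<Rightarrow> 't \<Rightarrow> 'a measure" where
  "distr_of M p \<theta> = density M (\<lambda>x. ennreal (p \<theta> x))"

definition q_lt :: "'a measure \<Rightarrow> ('a \<Rightarrow> real) \<Rightarrow> ('t \<Rightarrow> 'a \<Rightarrow> real) \<Rightarrow> 't \<Rightarrow> 'a \<Rightarrow> real" where
  "q_lt M f p \<theta> x = measure (distr_of M p \<theta>) {y \<in> space M. f y < f x}"

definition q_le :: "'a measure \<Rightarrow> ('a \<Rightarrow> real) \<Rightarrow> ('t \<Rightarrow> 'a \<Rightarrow> real) \<Rightarrow> 't \<Rightarrow> 'a \<Rightarrow> real" where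
  "q_le M f p \<theta> x = measure (distr_of M p \<theta>) {y \<in> space M. f y \<le> f x}"

definition preference ::
  "'a measure \<Rightarrow> ('a \<Rightarrow> real) \<Rightarrow> ('t \<Rightarrow> 'a \<Rightarrow> real) \<Rightarrow> (real \<Rightarrow> real) \<Rightarrow> 't \<Rightarrow> 'a \<Rightarrow> real" where
  "preference M f p w \<theta> x =
     (if q_le M f p \<theta> x = q_lt M f p \<theta> x then w (q_le M f p \<theta> x)
      else (1 / (q_le M f p \<theta> x - q_lt M f p \<theta> x)) *
           (LINT u:{q_lt M f p \<theta> x..q_le M f p \<theta> x}|lborel. w u))"

definition Z_weight :: "(real \<Rightarrow> real) \<Rightarrow> real" where
  "Z_weight w = (LINT u:{0..1}|lborel. w u)"

text \<open>The argument order follows \<open>J(\<theta>|\<theta>')\<close>: samples come from \<open>\<theta>\<close>, the preference from \<open>\<theta>'\<close>.\<close>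

definition J_obj ::
  "'a measure \<Rightarrow> ('a \<Rightarrow> real) \<Rightarrow> ('t \<Rightarrow> 'a \<Rightarrow> real) \<Rightarrow> (real \<Rightarrow> real) \<Rightarrow> 't \<Rightarrow> 't \<Rightarrow> real" where
  "J_obj M f p w \<theta> \<theta>' = (LINT x|distr_of M p \<theta>. preference M f p w \<theta>' x)"

definition target_density ::
  "'a measure \<Rightarrow> ('a \<Rightarrow> real) \<Rightarrow> ('t \<Rightarrow> 'a \<Rightarrow> real) \<Rightarrow> (real \<Rightarrow> real) \<Rightarrow> 't \<Rightarrow> 'a \<Rightarrow> real" where
  "target_density M f p w \<theta> x = (1 / Z_weight w) * preference M f p w \<theta> x * p \<theta> x"

text \<open>The divergence is extended-real valued, since the Bochner integral would return the junk
  value \<open>0\<close> for a divergent integral and \<open>ln (a / 0)\<close> evaluates to \<open>0\<close>. Here \<open>e2ennreal\<close> truncates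
  negative values to \<open>0\<close>, so the integral is that of the positive part minus that of the negative
  part. For probability densities the latter is finite, because
  \<open>- a ln (a / b) \<le> b - a\<close>; hence \<open>\<infinity> - \<infinity>\<close> does not occur.\<close>

definition KL_integrand :: "real \<Rightarrow> real \<Rightarrow> ereal" where
  "KL_integrand a b =
     (if a = 0 then 0 else if b = 0 then \<infinity> else ereal (ln (a / b) * a))"

definition KL_div :: "'a measure \<Rightarrow> ('a \<Rightarrow> real) \<Rightarrow> ('a \<Rightarrow> real) \<Rightarrow> ereal" where
  "KL_div M p1 p2 =
     enn2ereal (\<integral>\<^sup>+ x. e2ennreal (KL_integrand (p1 x) (p2 x)) \<partial>M) -
     enn2ereal (\<integral>\<^sup>+ x. e2ennreal (- KL_integrand (p1 x) (p2 x)) \<partial>M)"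

end

theory Submission
  imports Defs
begin

text \<open>Write \<open>p\<close>, \<open>q\<close> for the old and new densities, \<open>W\<close> for the preference, \<open>Z\<close> for the total weight
  and \<open>a = W p / Z\<close> for the target. Since \<open>W\<close> is bounded, \<open>KL(a, p)\<close> is finite, hence so is
  \<open>KL(a, q)\<close>, and \<open>q\<close> vanishes almost nowhere on the support of \<open>a\<close>. Instead of Jensen's
  inequality one integrates
  \<open>a ln (q / p) \<le> a (q / (c p) - 1 + ln c) = W q / (c Z) + (ln c - 1) a\<close>
  with \<open>c = exp \<Delta>\<close>: the left side has integral at least \<open>\<Delta>\<close>, so the integral of \<open>W q\<close> is at
  least \<open>c Z\<close>. That \<open>W p\<close> has integral \<open>Z\<close> follows from the quantile transform of the law of \<open>f\<close>.\<close>

section \<open>Means of a non-increasing weight over intervals\<close>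

text \<open>\<open>preference\<close> with its two quantiles turned into free endpoints: the point
  \<open>x\<close> then enters only through \<open>a\<close> and \<open>b\<close>.\<close>

definition interval_mean :: "(real \<Rightarrow> real) \<Rightarrow> real \<Rightarrow> real \<Rightarrow> real" where
  "interval_mean w a b =
     (if b = a then w b else (1 / (b - a)) * (LINT u:{a..b}|lborel. w u))"

lemma interval_mean_cong:
  assumes "a \<le> b" "\<And>u. u \<in> {a..b} \<Longrightarrow> w u = v u"
  shows "interval_mean w a b = interval_mean v a b"
proof -
  have "(LINT u:{a..b}|lborel. w u) = (LINT u:{a..b}|lborel. v u)"
    unfolding set_lebesgue_integral_def
    by (rule Bochner_Integration.integral_cong) (auto simp: indicator_def assms)
  then show ?thesis
    using assms by (simp add: interval_mean_def)
qed

context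
  fixes w :: "real \<Rightarrow> real"
  assumes w_anti: "antimono w" and w_nonneg: "\<And>u. 0 \<le> w u"
begin

lemma borel_measurable_antimono: "w \<in> borel_measurable borel"
proof -
  have "mono (\<lambda>u. - w u)"
    using w_anti by (auto simp: mono_def antimono_def)
  then have "(\<lambda>u. - (- w u)) \<in> borel_measurable borel"
    by (intro borel_measurable_uminus borel_measurable_mono)
  then show ?thesis
    by simp
qed

lemma antimono_set_integrable: "set_integrable lborel {a..b} w"
  unfolding set_integrable_def
proof (rule integrableI_bounded_set[where A = "{a..b}" and B = "w a"])
  note [measurable] = borel_measurable_antimono
  show "(\<lambda>x. indicat_real {a..b} x *\<^sub>R w x) \<in> borel_measurable lborel"
    by measurable
  show "AE x in lborel. x \<in> {a..b} \<longrightarrow> norm (indicat_real {a..b} x *\<^sub>R w x) \<le> w a"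
    using w_anti w_nonneg by (auto simp: antimono_def)
qed (auto simp: emeasure_lborel_Icc_eq)

lemma interval_mean_nonneg:
  assumes "a \<le> b" shows "0 \<le> interval_mean w a b"
  using assms w_nonneg
  by (auto simp: interval_mean_def set_lebesgue_integral_def
      intro!: mult_nonneg_nonneg divide_nonneg_nonneg integral_nonneg_AE)

lemma interval_mean_le:
  assumes "a \<le> b" shows "interval_mean w a b \<le> w a"
proof (cases "a = b")
  case False
  with assms have "a < b" by simp
  have "(LINT u:{a..b}|lborel. w u) \<le> (LINT u:{a..b}|lborel. w a)"
    using w_anti by (intro set_integral_mono antimono_set_integrable)
      (auto simp: antimono_def set_integrable_def integrable_indicator_iff emeasure_lborel_Icc_eq)
  also have "\<dots> = (b - a) * w a"
    using assms by (simp add: set_lebesgue_integral_def)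
  finally show ?thesis
    using \<open>a < b\<close> by (simp add: interval_mean_def field_simps)
qed (simp add: interval_mean_def)

text \<open>This is why atoms of the law of the objective do no harm: averaging the weight over a
  gap keeps its mass there. The interval is open to match the gaps on which the quantile function is
  constant; the endpoints are null.\<close>

lemma nn_integral_interval_mean:
  assumes "a < b"
  shows "(\<integral>\<^sup>+u. ennreal (interval_mean w a b) * indicator {a<..<b} u \<partial>lborel)
       = (\<integral>\<^sup>+u. ennreal (w u) * indicator {a<..<b} u \<partial>lborel)"
proof -
  have "(\<integral>\<^sup>+u. ennreal (interval_mean w a b) * indicator {a<..<b} u \<partial>lborel)
      = ennreal (interval_mean w a b) * ennreal (b - a)"
    using assms by (simp add: nn_integral_cmult_indicator)
  also have "\<dots> = ennreal (LINT u:{a..b}|lborel. w u)"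
    using assms interval_mean_nonneg[of a b]
    by (simp add: interval_mean_def flip: ennreal_mult)
  also have "\<dots> = (\<integral>\<^sup>+u. ennreal (indicator {a..b} u * w u) \<partial>lborel)"
    using antimono_set_integrable[of a b] w_nonneg
    by (subst nn_integral_eq_integral) (auto simp: set_lebesgue_integral_def set_integrable_def)
  also have "\<dots> = (\<integral>\<^sup>+u. ennreal (w u) * indicator {a<..<b} u \<partial>lborel)"
  proof (rule nn_integral_cong_AE)
    show "AE u in lborel. ennreal (indicator {a..b} u * w u) = ennreal (w u) * indicator {a<..<b} u"
      using AE_lborel_singleton[of a] AE_lborel_singleton[of b]
      by eventually_elim (auto simp: indicator_def)
  qed
  finally show ?thesis .
qed

text \<open>An integral with variable endpoints becomes an integral over the whole line of a
  function jointly measurable in \<open>x\<close> and \<open>u\<close>, so measurability in the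
  parameter applies.\<close>

lemma borel_measurable_interval_mean:
  assumes [measurable]: "g \<in> borel_measurable N" "h \<in> borel_measurable N"
  shows "(\<lambda>x. interval_mean w (g x) (h x)) \<in> borel_measurable N"
proof -
  note [measurable] = borel_measurable_antimono
  have "(\<lambda>x. LINT u|lborel. (if g x \<le> u \<and> u \<le> h x then w u else 0)) \<in> borel_measurable N"
    by measurable
  moreover have "(LINT u|lborel. (if g x \<le> u \<and> u \<le> h x then w u else 0))
    = (LINT u:{g x..h x}|lborel. w u)" for x
    unfolding set_lebesgue_integral_def
    by (rule Bochner_Integration.integral_cong) (auto simp: indicator_def)
  ultimately have [measurable]: "(\<lambda>x. LINT u:{g x..h x}|lborel. w u) \<in> borel_measurable N"
    by simp
  show ?thesis
    unfolding interval_mean_def by measurable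
qed

end

section \<open>Quantile functions and integration against a real distribution\<close>

context cdf_distribution
begin

lemma measure_lessThan_le_cdf: "measure M {..<t} \<le> C t"
  unfolding cdf_def by (intro finite_measure_mono) auto

lemma cdf_le_measure_lessThan: "s < t \<Longrightarrow> C s \<le> measure M {..<t}"
  unfolding cdf_def by (intro finite_measure_mono) auto

lemma cdf_eq_measure_lessThan_plus: "C t = measure M {..<t} + measure M {t}"
proof -
  have "{..t} = {..<t} \<union> {t}" by auto
  then show ?thesis
    unfolding cdf_def by (subst finite_measure_Union[symmetric]) auto
qed

lemma borel_measurable_measure_lessThan [measurable]:
  "(\<lambda>t. measure M {..<t}) \<in> borel_measurable borel"
  by (intro borel_measurable_mono monoI finite_measure_mono) auto

text \<open>The Galois connection \<open>u \<le> C x\<close> iff \<open>I u \<le> x\<close>, read at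
  \<open>x = I u\<close>.\<close>

lemma le_cdf_quantile: "0 < u \<Longrightarrow> u < 1 \<Longrightarrow> u \<le> C (I u)"
  by (rule pseudoinverse[THEN iffD2]) auto

text \<open>By the Galois connection \<open>C s < u\<close> for all \<open>s < I u\<close>, and the
  mass of \<open>{..<t}\<close> is the left limit of \<open>C\<close> at \<open>t\<close>.\<close>

lemma measure_lessThan_quantile_le:
  assumes "0 < u" "u < 1" shows "measure M {..<I u} \<le> u"
proof (rule tendsto_upperbound[OF cdf_at_left])
  have "C s \<le> u" if "s < I u" for s
    using that pseudoinverse[OF assms, of s] by linarith
  then show "\<forall>\<^sub>F s in at_left (I u). C s \<le> u"
    by (intro eventually_at_leftI[of "I u - 1"]) auto
qed simp

text \<open>The quantile function is constant on the jump of \<open>C\<close> at an atom: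
  \<open>I u < t\<close> would give \<open>u \<le> C (I u) \<le> measure M {..<t}\<close>.\<close>

lemma quantile_eqI:
  assumes "measure M {..<t} < u" "u < C t" shows "I u = t"
proof -
  have u: "0 < u" "u < 1"
    using assms cdf_bounded_prob[of t] measure_nonneg[of M "{..<t}"] by linarith+
  then have "I u \<le> t"
    using pseudoinverse[OF u, of t] assms(2) by linarith
  moreover have "\<not> I u < t"
    using cdf_le_measure_lessThan[of "I u" t] le_cdf_quantile[OF u] assms(1) by linarith
  ultimately show ?thesis by linarith
qed

text \<open>The quantile transform turns the left side into an integral over the unit interval. Atoms
  \<open>t\<close> of the distribution correspond to the disjoint intervals between the left limit and the
  value of the distribution function at \<open>t\<close>; there the integrand is the mean of \<open>w\<close>, and up to
  countably many points it is \<open>w\<close> itself elsewhere.\<close>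

lemma nn_integral_interval_mean_cdf:
  assumes w: "antimono w" "\<And>u. 0 \<le> w u"
  shows "(\<integral>\<^sup>+t. ennreal (interval_mean w (measure M {..<t}) (C t)) \<partial>M)
       = (\<integral>\<^sup>+u. ennreal (w u) * indicator {0<..<1} u \<partial>lborel)"
proof -
  note [measurable] = borel_measurable_antimono[OF w]
  define L where "L t = measure M {..<t}" for t
  define h where "h t = ennreal (interval_mean w (L t) (C t))" for t
  define g where "g u = h (I u) * indicator {0<..<1} u" for u
  define v where "v u = ennreal (w u) * indicator {0<..<1} u" for u
  define A where "A = {t. measure M {t} > 0}"
  define S where "S t = {L t<..<C t}" for t
  define D where "D = (\<Union>t\<in>A. S t)"
  have [measurable]: "h \<in> borel_measurable borel"
    using borel_measurable_interval_mean[OF w] unfolding h_def L_def by measurable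
  \<comment> \<open>Measurability of \<open>I\<close> is a fact about the restriction to the open
    unit interval, so that of \<open>g\<close> is checked there.\<close>
  have g_meas [measurable]: "g \<in> borel_measurable borel"
    unfolding g_def by (subst borel_measurable_restrict_space_iff_ennreal[symmetric]) auto
  have v_meas [measurable]: "v \<in> borel_measurable borel"
    unfolding v_def by measurable
  have A: "countable A"
    unfolding A_def by (rule countable_atoms)
  have [measurable]: "S t \<in> sets borel" for t
    unfolding S_def by simp
  have [measurable]: "D \<in> sets borel"
    unfolding D_def by (intro sets.countable_UN'' A) measurable
  have S01: "S t \<subseteq> {0<..<1}" for t
    using cdf_bounded_prob[of t] by (auto simp: S_def L_def intro: le_less_trans[OF measure_nonneg])
  have S_I: "I u = t" if "u \<in> S t" for u t
    using quantile_eqI that by (auto simp: S_def L_def)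
  have disj: "disjoint_family_on S A"
    unfolding disjoint_family_on_def using S_I by blast
  have AE_off: "AE u in lborel. u \<notin> D \<longrightarrow> g u = v u"
  proof (rule AE_I')
    have "countable (L ` A \<union> C ` A)"
      using A by simp
    then show "L ` A \<union> C ` A \<in> null_sets lborel"
      by (rule countable_imp_null_set_lborel)
    show "{u \<in> space lborel. \<not> (u \<notin> D \<longrightarrow> g u = v u)} \<subseteq> L ` A \<union> C ` A"
    proof (rule subsetI, rule UnCI)
      fix u assume "u \<in> {u \<in> space lborel. \<not> (u \<notin> D \<longrightarrow> g u = v u)}" "u \<notin> C ` A"
      then have u: "u \<notin> D" "g u \<noteq> v u" "u \<notin> C ` A"
        by auto
      then have u01: "0 < u" "u < 1"
        by (auto simp: g_def v_def indicator_def split: if_splits)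
      \<comment> \<open>The bounds \<open>L t \<le> u \<le> C t\<close> decide both cases. If
        \<open>t\<close> is no atom, they pinch \<open>u\<close> and the mean degenerates to
        \<open>w u\<close>. If it is one, \<open>u\<close> lies in the closed gap but not in the
        open one, hence is an endpoint.\<close>
      define t where "t = I u"
      have tu: "L t \<le> u" "u \<le> C t"
        using le_cdf_quantile[OF u01] measure_lessThan_quantile_le[OF u01] by (auto simp: t_def L_def)
      have "t \<in> A"
      proof (rule ccontr)
        assume "t \<notin> A"
        then have "measure M {t} = 0"
          using measure_nonneg[of M "{t}"] unfolding A_def mem_Collect_eq by linarith
        then have "L t = u" "C t = u"
          using tu cdf_eq_measure_lessThan_plus[of t] by (auto simp: L_def)
        then have "g u = v u"
          using u01 by (simp add: g_def v_def h_def interval_mean_def flip: t_def)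
        with u show False by simp
      qed
      with u tu show "u \<in> L ` A"
        unfolding D_def S_def by force
    qed
  qed
  have "(\<integral>\<^sup>+u. g u * indicator D u \<partial>lborel) = (\<integral>\<^sup>+u. v u * indicator D u \<partial>lborel)"
  proof -
    have eq: "(\<integral>\<^sup>+u. g u * indicator (S t) u \<partial>lborel) = (\<integral>\<^sup>+u. v u * indicator (S t) u \<partial>lborel)"
      if "t \<in> A" for t
    proof -
      have "L t < C t"
        using that cdf_eq_measure_lessThan_plus[of t] by (auto simp: A_def L_def)
      have "(\<integral>\<^sup>+u. g u * indicator (S t) u \<partial>lborel) = (\<integral>\<^sup>+u. h t * indicator (S t) u \<partial>lborel)"
        using S_I S01[of t] by (intro nn_integral_cong) (auto simp: g_def indicator_def)
      also have "\<dots> = (\<integral>\<^sup>+u. ennreal (w u) * indicator (S t) u \<partial>lborel)"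
        unfolding h_def S_def by (rule nn_integral_interval_mean[OF w \<open>L t < C t\<close>])
      also have "\<dots> = (\<integral>\<^sup>+u. v u * indicator (S t) u \<partial>lborel)"
        using S01[of t] by (intro nn_integral_cong) (auto simp: v_def indicator_def)
      finally show ?thesis .
    qed
    \<comment> \<open>Reading the integrals as measures with densities \<open>g\<close> and
      \<open>v\<close> makes countable additivity over the disjoint gaps available.\<close>
    have "emeasure (density lborel g) D = (\<integral>\<^sup>+t. emeasure (density lborel g) (S t) \<partial>count_space A)"
      unfolding D_def by (rule emeasure_UN_countable[OF _ A disj]) simp
    also have "\<dots> = (\<integral>\<^sup>+t. emeasure (density lborel v) (S t) \<partial>count_space A)"
      using eq by (intro nn_integral_cong) (simp add: emeasure_density)
    also have "\<dots> = emeasure (density lborel v) D"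
      unfolding D_def by (rule emeasure_UN_countable[OF _ A disj, symmetric]) simp
    finally show ?thesis
      by (simp add: emeasure_density)
  qed
  moreover have "(\<integral>\<^sup>+u. g u * indicator (- D) u \<partial>lborel) = (\<integral>\<^sup>+u. v u * indicator (- D) u \<partial>lborel)"
    using AE_off by (intro nn_integral_cong_AE) (auto elim!: eventually_mono simp: indicator_def)
  moreover have "(\<integral>\<^sup>+u. k u \<partial>lborel)
      = (\<integral>\<^sup>+u. k u * indicator D u \<partial>lborel) + (\<integral>\<^sup>+u. k u * indicator (- D) u \<partial>lborel)"
    if [measurable]: "k \<in> borel_measurable borel" for k :: "real \<Rightarrow> ennreal"
    by (subst nn_integral_add[symmetric]) (auto intro!: nn_integral_cong simp: indicator_def)
  note this[OF g_meas] this[OF v_meas]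
  ultimately have "(\<integral>\<^sup>+u. g u \<partial>lborel) = (\<integral>\<^sup>+u. v u \<partial>lborel)"
    by (simp only:)
  moreover have "(\<integral>\<^sup>+t. h t \<partial>M) = (\<integral>\<^sup>+u. g u \<partial>lborel)"
  proof -
    have "(\<integral>\<^sup>+t. h t \<partial>M) = (\<integral>\<^sup>+t. h t \<partial>distr (restrict_space lborel {0<..<1}) borel I)"
      by (simp add: distr_I_eq_M)
    also have "\<dots> = (\<integral>\<^sup>+u. h (I u) \<partial>restrict_space lborel {0<..<1})"
      by (intro nn_integral_distr) auto
    also have "\<dots> = (\<integral>\<^sup>+u. g u \<partial>lborel)"
      by (simp add: nn_integral_restrict_space g_def)
    finally show ?thesis .
  qed
  ultimately show ?thesis
    by (simp add: h_def L_def v_def)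
qed

end

section \<open>The divergence as a finite real integral\<close>

text \<open>The negative part is always integrable, since
  \<open>- a ln (a / b) = a ln (b / a) \<le> b\<close>. A divergence other than \<infinity>
  therefore has an integrable positive part, so the value \<infinity> of the integrand is confined
  to a null set. Off that set the integrand is the real expression; where \<open>a x = 0\<close>
  both vanish.\<close>

lemma
  assumes [measurable]: "a \<in> borel_measurable M" "b \<in> borel_measurable M"
    and nonneg: "\<forall>x\<in>space M. 0 \<le> a x" "\<forall>x\<in>space M. 0 \<le> b x"
    and b_int: "integrable M b"
    and fin: "KL_div M a b \<noteq> \<infinity>"
  shows KL_div_finite_imp_AE: "AE x in M. b x = 0 \<longrightarrow> a x = 0"
    and KL_div_finite_imp_integrable: "integrable M (\<lambda>x. ln (a x / b x) * a x)"
    and KL_div_eq_integral: "KL_div M a b = ereal (\<integral>x. ln (a x / b x) * a x \<partial>M)"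
proof -
  define P where "P = (\<integral>\<^sup>+ x. e2ennreal (KL_integrand (a x) (b x)) \<partial>M)"
  define N where "N = (\<integral>\<^sup>+ x. e2ennreal (- KL_integrand (a x) (b x)) \<partial>M)"
  have KL: "KL_div M a b = enn2ereal P - enn2ereal N"
    by (simp add: KL_div_def P_def N_def)
  have "N \<le> (\<integral>\<^sup>+ x. ennreal (b x) \<partial>M)"
    unfolding N_def
  proof (rule nn_integral_mono)
    fix x assume "x \<in> space M"
    note * = nonneg[THEN bspec, OF this]
    have "a x * - ln (a x / b x) \<le> b x" if "a x \<noteq> 0" "b x \<noteq> 0"
    proof -
      have "- ln (a x / b x) = ln (b x / a x)"
        using that * by (simp add: ln_div)
      also have "\<dots> \<le> b x / a x"
        using that * by (intro less_imp_le ln_less_self) simp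
      finally have "a x * - ln (a x / b x) \<le> a x * (b x / a x)"
        using * by (intro mult_left_mono)
      with that show ?thesis by simp
    qed
    then show "e2ennreal (- KL_integrand (a x) (b x)) \<le> ennreal (b x)"
      using * by (auto simp: KL_integrand_def e2ennreal_neg mult.commute intro: ennreal_leI)
  qed
  also have "\<dots> < \<infinity>"
    using b_int nonneg by (subst nn_integral_eq_integral) auto
  finally have N: "N \<noteq> \<infinity>" by simp
  with fin have P: "P \<noteq> \<infinity>"
    unfolding KL by (cases N) auto
  have "(\<lambda>x. e2ennreal (KL_integrand (a x) (b x))) \<in> borel_measurable M"
    unfolding KL_integrand_def by measurable
  from nn_integral_PInf_AE[OF this] P
  have "AE x in M. e2ennreal (KL_integrand (a x) (b x)) \<noteq> \<infinity>"
    by (simp add: P_def)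
  then show AE: "AE x in M. b x = 0 \<longrightarrow> a x = 0"
    by eventually_elim (auto simp: KL_integrand_def split: if_splits)
  then have eq: "AE x in M. KL_integrand (a x) (b x) = ereal (ln (a x / b x) * a x)"
    by eventually_elim (auto simp: KL_integrand_def)
  have P': "P = (\<integral>\<^sup>+ x. ennreal (ln (a x / b x) * a x) \<partial>M)"
    unfolding P_def using eq by (intro nn_integral_cong_AE) (auto elim!: eventually_mono)
  have N': "N = (\<integral>\<^sup>+ x. ennreal (- (ln (a x / b x) * a x)) \<partial>M)"
    unfolding N_def using eq by (intro nn_integral_cong_AE) (auto elim!: eventually_mono)
  show int: "integrable M (\<lambda>x. ln (a x / b x) * a x)"
    using P N unfolding P' N' by (simp add: real_integrable_def)
  show "KL_div M a b = ereal (\<integral>x. ln (a x / b x) * a x \<partial>M)"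
    using P N unfolding KL real_lebesgue_integral_def[OF int] P'[symmetric] N'[symmetric]
    by (cases P; cases N) auto
qed

text \<open>Where \<open>a\<close> is positive so is \<open>b\<close>, and
  \<open>ln (a / b) \<le> a / b \<le> c\<close> bounds the positive part by a multiple of
  \<open>a\<close>.\<close>

lemma KL_div_not_infty_of_bounded_ratio:
  assumes nonneg: "\<And>x. x \<in> space M \<Longrightarrow> 0 \<le> a x" "\<And>x. x \<in> space M \<Longrightarrow> 0 \<le> b x"
    and le: "\<And>x. x \<in> space M \<Longrightarrow> a x \<le> c * b x"
    and a_int: "integrable M a"
  shows "KL_div M a b \<noteq> \<infinity>"
proof -
  define P where "P = (\<integral>\<^sup>+ x. e2ennreal (KL_integrand (a x) (b x)) \<partial>M)"
  have "P \<le> (\<integral>\<^sup>+ x. ennreal (norm (c * a x)) \<partial>M)"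
    unfolding P_def
  proof (rule nn_integral_mono)
    fix x assume x: "x \<in> space M"
    note * = nonneg[OF x] le[OF x]
    have "ln (a x / b x) * a x \<le> \<bar>c * a x\<bar>" if "a x \<noteq> 0" "b x \<noteq> 0"
    proof -
      have "ln (a x / b x) \<le> a x / b x"
        using that * by (intro less_imp_le ln_less_self) simp
      also have "\<dots> \<le> c"
        using that * by (simp add: field_simps)
      finally have "ln (a x / b x) * a x \<le> c * a x"
        using * by (intro mult_right_mono)
      then show ?thesis by simp
    qed
    then show "e2ennreal (KL_integrand (a x) (b x)) \<le> ennreal (norm (c * a x))"
      using * by (auto simp: KL_integrand_def intro: ennreal_leI)
  qed
  also have "\<dots> < \<infinity>"
    using a_int by (intro integrable_iff_bounded[THEN iffD1, THEN conjunct2]) simp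
  finally have "P \<noteq> \<infinity>" by simp
  \<comment> \<open>With \<open>P\<close> finite the difference cannot be \<infinity>, whatever the
    negative part is.\<close>
  then show ?thesis
    unfolding KL_div_def P_def[symmetric]
    by (cases P; cases "(\<integral>\<^sup>+ x. e2ennreal (- KL_integrand (a x) (b x)) \<partial>M)") auto
qed

section \<open>From a decrease of divergence to a gain in expected preference\<close>

text \<open>The tangent to \<open>ln\<close> at \<open>exp \<Delta>\<close> touches at
  \<open>q x = exp \<Delta> * p x\<close>, which is why the factor \<open>exp \<Delta>\<close> comes
  out without loss. Boundedness of \<open>W\<close> gives integrability of its products with
  \<open>p\<close> and \<open>q\<close>, and a finite divergence from \<open>a\<close> to
  \<open>p\<close>.\<close>

lemma KL_decrease_imp_integral_ge:
  fixes W p q :: "'a \<Rightarrow> real"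
  assumes W [measurable]: "W \<in> borel_measurable M"
    and W_bounds: "\<And>x. x \<in> space M \<Longrightarrow> 0 \<le> W x" "\<And>x. x \<in> space M \<Longrightarrow> W x \<le> B"
    and p: "integrable M p" "\<And>x. x \<in> space M \<Longrightarrow> 0 \<le> p x"
    and q: "integrable M q" "\<And>x. x \<in> space M \<Longrightarrow> 0 \<le> q x"
    and Z: "Z = (\<integral>x. p x * W x \<partial>M)" "0 < Z"
    and a: "a = (\<lambda>x. 1 / Z * W x * p x)"
    and step: "KL_div M a q + ereal \<Delta> \<le> KL_div M a p"
  shows "exp \<Delta> * Z \<le> (\<integral>x. q x * W x \<partial>M)"
proof -
  note p_meas [measurable] = borel_measurable_integrable[OF p(1)]
  note q_meas [measurable] = borel_measurable_integrable[OF q(1)]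
  have int_W: "integrable M (\<lambda>x. r x * W x)" if "integrable M r" for r
  proof (rule Bochner_Integration.integrable_bound[where f = "\<lambda>x. B * r x"])
    show "AE x in M. norm (r x * W x) \<le> norm (B * r x)"
    proof (rule AE_I2)
      fix x assume "x \<in> space M"
      from W_bounds[OF this] show "norm (r x * W x) \<le> norm (B * r x)"
        by (simp add: abs_mult mult.commute[of "\<bar>r x\<bar>"] mult_right_mono)
    qed
  qed (use that in auto)
  have a_int: "integrable M a"
    using int_W[OF p(1)] by (simp add: a mult.assoc mult.commute[of "W _"])
  note a_meas [measurable] = borel_measurable_integrable[OF a_int]
  have a_nonneg: "0 \<le> a x" if "x \<in> space M" for x
    using W_bounds[OF that] p(2)[OF that] Z by (simp add: a)
  have a_1: "(\<integral>x. a x \<partial>M) = 1"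
  proof -
    have "(\<integral>x. a x \<partial>M) = (\<integral>x. (p x * W x) / Z \<partial>M)"
      by (simp add: a mult.commute)
    with Z show ?thesis by simp
  qed
  \<comment> \<open>With an infinite right side \<open>step\<close> would hold trivially and carry
    no information about \<open>q\<close>.\<close>
  have p_fin: "KL_div M a p \<noteq> \<infinity>"
  proof (rule KL_div_not_infty_of_bounded_ratio[OF a_nonneg p(2) _ a_int])
    fix x assume x: "x \<in> space M"
    show "a x \<le> (B / Z) * p x"
      using W_bounds[OF x] p(2)[OF x] Z by (simp add: a divide_right_mono mult_right_mono)
  qed
  with step have q_fin: "KL_div M a q \<noteq> \<infinity>"
    by auto
  have nn: "\<forall>x\<in>space M. 0 \<le> a x" "\<forall>x\<in>space M. 0 \<le> p x" "\<forall>x\<in>space M. 0 \<le> q x"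
    using a_nonneg p(2) q(2) by auto
  note Lp = KL_div_finite_imp_AE[OF a_meas p_meas nn(1,2) p(1) p_fin]
    KL_div_finite_imp_integrable[OF a_meas p_meas nn(1,2) p(1) p_fin]
    KL_div_eq_integral[OF a_meas p_meas nn(1,2) p(1) p_fin]
  note Lq = KL_div_finite_imp_AE[OF a_meas q_meas nn(1,3) q(1) q_fin]
    KL_div_finite_imp_integrable[OF a_meas q_meas nn(1,3) q(1) q_fin]
    KL_div_eq_integral[OF a_meas q_meas nn(1,3) q(1) q_fin]
  define c where "c = exp \<Delta>"
  have c: "0 < c" "ln c = \<Delta>"
    by (simp_all add: c_def)
  have *: "(\<integral>x. ln (a x / q x) * a x \<partial>M) + \<Delta> \<le> (\<integral>x. ln (a x / p x) * a x \<partial>M)"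
    using step Lp(3) Lq(3) by simp
  \<comment> \<open>Only almost everywhere: where \<open>q x = 0 < a x\<close>, the logarithm of
    \<open>a x / q x\<close> has the default value \<open>0\<close> and the bound can fail.\<close>
  have ineq: "AE x in M. ln (a x / p x) * a x
      \<le> ln (a x / q x) * a x + (q x * W x) / (c * Z) + (\<Delta> - 1) * a x"
    using Lq(1) AE_space
  proof eventually_elim
    fix x assume ac: "q x = 0 \<longrightarrow> a x = 0" and x: "x \<in> space M"
    note nn = W_bounds(1)[OF x] p(2)[OF x] q(2)[OF x] a_nonneg[OF x]
    show "ln (a x / p x) * a x
      \<le> ln (a x / q x) * a x + (q x * W x) / (c * Z) + (\<Delta> - 1) * a x"
    proof (cases "a x = 0")
      case True
      then show ?thesis using nn c Z by simp
    next
      case False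
      then have pos: "0 < a x" "0 < p x" "0 < q x"
        using nn ac by (auto simp: a less_le)
      \<comment> \<open>The tangent bound; \<open>ln (q x / p x)\<close> is the difference of the
        two log ratios of \<open>a x\<close>, so the divergence integrands appear.\<close>
      have "ln (q x / (c * p x)) \<le> q x / (c * p x) - 1"
        using pos c by (intro ln_le_minus_one) simp
      then have "ln (a x / p x) \<le> ln (a x / q x) + (q x / (c * p x) + (\<Delta> - 1))"
        using pos c by (simp add: ln_div ln_mult)
      then have "ln (a x / p x) * a x \<le> (ln (a x / q x) + (q x / (c * p x) + (\<Delta> - 1))) * a x"
        using pos by (intro mult_right_mono) auto
      moreover have "q x / (c * p x) * a x = (q x * W x) / (c * Z)"
        using pos by (simp add: a)
      ultimately show ?thesis
        by (simp add: algebra_simps)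
    qed
  qed
  have "(\<integral>x. ln (a x / p x) * a x \<partial>M)
      \<le> (\<integral>x. ln (a x / q x) * a x + (q x * W x) / (c * Z) + (\<Delta> - 1) * a x \<partial>M)"
    using Lp(2) Lq(2) a_int int_W[OF q(1)] by (intro integral_mono_AE ineq) auto
  also have "\<dots> = (\<integral>x. ln (a x / q x) * a x \<partial>M) + (\<integral>x. q x * W x \<partial>M) / (c * Z) + (\<Delta> - 1)"
    using Lq(2) a_int int_W[OF q(1)] a_1 by simp
  \<comment> \<open>By \<open>*\<close> the divergence terms differ by at least
    \<open>\<Delta>\<close>, which cancels the \<open>\<Delta>\<close> on the right. What stays is
    the \<open>1\<close> of the tangent, as \<open>a\<close> has integral one.\<close>
  finally have "1 \<le> (\<integral>x. q x * W x \<partial>M) / (c * Z)"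
    using * by simp
  then show ?thesis
    using c Z by (simp add: c_def field_simps)
qed

section \<open>Preference and objective in terms of the law of \<open>f\<close>\<close>

lemma prob_densityD:
  assumes "prob_density M p"
  shows "p \<in> borel_measurable M" "\<And>x. x \<in> space M \<Longrightarrow> 0 \<le> p x" "integrable M p"
proof -
  show p: "p \<in> borel_measurable M" "\<And>x. x \<in> space M \<Longrightarrow> 0 \<le> p x"
    using assms by (auto simp: prob_density_def)
  have "emeasure (density M (\<lambda>x. ennreal (p x))) (space M) = 1"
    using assms prob_space.emeasure_space_1[of "density M (\<lambda>x. ennreal (p x))"]
    by (simp add: prob_density_def)
  then have "(\<integral>\<^sup>+x. ennreal (p x) \<partial>M) = 1"
    using p(1) by (simp add: emeasure_density cong: nn_integral_cong)
  then show "integrable M p"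
    using p by (intro integrableI_nonneg) auto
qed

lemma J_obj_eq_integral:
  assumes "prob_density M (p \<theta>)" "preference M f p w \<theta>' \<in> borel_measurable M"
  shows "J_obj M f p w \<theta> \<theta>' = (\<integral>x. p \<theta> x * preference M f p w \<theta>' x \<partial>M)"
  using prob_densityD[OF assms(1)] assms(2)
  unfolding J_obj_def distr_of_def by (subst integral_density) auto

text \<open>\<open>w\<close> is only controlled on the unit interval; composing it with the projection onto that
  interval makes it antimonotone, hence Borel, on the whole line without changing any preference.\<close>

lemma
  fixes f :: "'a \<Rightarrow> real"
  assumes f [measurable]: "f \<in> borel_measurable M"
    and p: "prob_density M (p \<theta>)"
    and w_nonneg: "\<forall>u\<in>{0..1}. 0 \<le> w u"
    and w_noninc: "antimono_on {0..1} w"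
  shows borel_measurable_preference: "preference M f p w \<theta> \<in> borel_measurable M"
    and preference_nonneg: "0 \<le> preference M f p w \<theta> x"
    and preference_le: "preference M f p w \<theta> x \<le> w 0"
    and J_obj_self: "J_obj M f p w \<theta> \<theta> = Z_weight w"
proof -
  define v where "v u = w (max 0 (min 1 u))" for u
  have v_eq: "v u = w u" if "u \<in> {0..1}" for u
    using that by (simp add: v_def)
  have v: "antimono v" "\<And>u. 0 \<le> v u"
    using w_noninc w_nonneg by (auto simp: v_def antimono_def monotone_on_def)
  define Q where "Q = distr_of M p \<theta>"
  define P where "P = distr Q borel f"
  interpret Q: prob_space Q
    using p by (simp add: Q_def distr_of_def prob_density_def)
  have [simp, measurable_cong]: "sets Q = sets M" and [simp]: "space Q = space M"
    by (simp_all add: Q_def distr_of_def)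
  interpret P: real_distribution P
    unfolding P_def by (intro Q.real_distribution_distr) measurable
  interpret P: cdf_distribution P ..
  define V where "V t = interval_mean v (measure P {..<t}) (P.C t)" for t
  have bounds: "0 \<le> measure P {..<t}" "measure P {..<t} \<le> P.C t" "P.C t \<le> 1" for t
    using P.measure_lessThan_le_cdf P.cdf_bounded_prob by auto
  \<comment> \<open>The two quantiles are the left limit and the value at \<open>f x\<close> of the
    distribution function of \<open>P\<close>, the law of \<open>f\<close>.\<close>
  have pref: "preference M f p w \<theta> x = V (f x)" for x
  proof -
    have "q_lt M f p \<theta> x = measure P {..<f x}" "q_le M f p \<theta> x = P.C (f x)"
      unfolding q_lt_def q_le_def P_def cdf_def Q_def[symmetric]
      by (subst measure_distr; auto intro!: arg_cong[where f = "measure Q"])+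
    then have "preference M f p w \<theta> x = interval_mean w (measure P {..<f x}) (P.C (f x))"
      by (simp add: preference_def interval_mean_def)
    also have "\<dots> = V (f x)"
      unfolding V_def using bounds[of "f x"]
      by (intro interval_mean_cong v_eq[symmetric]) (auto simp del: measure_nonneg intro: order_trans)
    finally show ?thesis .
  qed
  have V_meas [measurable]: "V \<in> borel_measurable borel"
    unfolding V_def by (intro borel_measurable_interval_mean[OF v]) auto
  show "preference M f p w \<theta> \<in> borel_measurable M"
    unfolding pref by measurable
  show nonneg: "0 \<le> preference M f p w \<theta> x" for x
    unfolding pref V_def by (intro interval_mean_nonneg[OF v] bounds)
  show "preference M f p w \<theta> x \<le> w 0"
  proof -
    \<comment> \<open>A mean of a non-increasing weight is at most its value at the left endpoint,
      and that endpoint is at least \<open>0\<close>.\<close>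
    have "V (f x) \<le> v (measure P {..<f x})"
      unfolding V_def by (intro interval_mean_le[OF v] bounds)
    also have "\<dots> \<le> v 0"
      using v(1) by (simp add: antimono_def)
    finally show ?thesis
      by (simp add: pref v_eq)
  qed
  have "J_obj M f p w \<theta> \<theta> = enn2real (\<integral>\<^sup>+x. ennreal (V (f x)) \<partial>Q)"
    unfolding J_obj_def Q_def[symmetric] pref
    using nonneg by (intro integral_eq_nn_integral) (auto simp: pref)
  also have "(\<integral>\<^sup>+x. ennreal (V (f x)) \<partial>Q) = (\<integral>\<^sup>+t. ennreal (V t) \<partial>P)"
    unfolding P_def by (intro nn_integral_distr[symmetric]) measurable
  also have "\<dots> = (\<integral>\<^sup>+u. ennreal (v u) * indicator {0<..<1} u \<partial>lborel)"
    unfolding V_def by (rule P.nn_integral_interval_mean_cdf[OF v])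
  \<comment> \<open>The averaging identity again, now on the whole unit interval, where the mean is
    the total weight.\<close>
  also have "\<dots> = ennreal (interval_mean v 0 1)"
    using nn_integral_interval_mean[OF v, of 0 1] by (simp add: nn_integral_cmult_indicator)
  also have "enn2real \<dots> = interval_mean v 0 1"
    using interval_mean_nonneg[OF v, of 0 1] by simp
  also have "\<dots> = interval_mean w 0 1"
    by (intro interval_mean_cong) (auto simp: v_eq)
  also have "\<dots> = Z_weight w"
    by (simp add: interval_mean_def Z_weight_def)
  finally show "J_obj M f p w \<theta> \<theta> = Z_weight w" .
qed

theorem proposition1:
  fixes M :: "'a measure"
    and f :: "'a \<Rightarrow> real"
    and \<Theta> :: "'t set"
    and p :: "'t \<Rightarrow> 'a \<Rightarrow> real"
    and w :: "real \<Rightarrow> real"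
    and \<theta> :: "nat \<Rightarrow> 't"
    and k :: nat
    and \<Delta> :: real
  assumes f_meas: "f \<in> borel_measurable M"
    and p_dens: "\<And>t. t \<in> \<Theta> \<Longrightarrow> prob_density M (p t)"
    and w_nonneg: "\<And>u. u \<in> {0..1} \<Longrightarrow> 0 \<le> w u"
    and w_noninc: "antimono_on {0..1} w"
    and Z_pos: "0 < Z_weight w"
    and theta_k: "\<theta> k \<in> \<Theta>"
    and theta_Suc_k: "\<theta> (Suc k) \<in> \<Theta>"
    and KL_step:
      "KL_div M (target_density M f p w (\<theta> k)) (p (\<theta> (Suc k))) + ereal \<Delta>
         \<le> KL_div M (target_density M f p w (\<theta> k)) (p (\<theta> k))"
  shows "J_obj M f p w (\<theta> (Suc k)) (\<theta> k) \<ge> exp \<Delta> * J_obj M f p w (\<theta> k) (\<theta> k) \<and>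
         exp \<Delta> * J_obj M f p w (\<theta> k) (\<theta> k) = exp \<Delta> * Z_weight w \<and>
         (\<Delta> > 0 \<longrightarrow>
            J_obj M f p w (\<theta> (Suc k)) (\<theta> k) > J_obj M f p w (\<theta> k) (\<theta> k) \<and>
            J_obj M f p w (\<theta> k) (\<theta> k) = Z_weight w)"
proof -
  define W where "W = preference M f p w (\<theta> k)"
  note pk = p_dens[OF theta_k] and pS = p_dens[OF theta_Suc_k]
  have w01: "\<forall>u\<in>{0..1}. 0 \<le> w u"
    using w_nonneg by blast
  note W = borel_measurable_preference[where p = p, OF f_meas pk w01 w_noninc, folded W_def]
    preference_nonneg[where p = p, OF f_meas pk w01 w_noninc, folded W_def]
    preference_le[where p = p, OF f_meas pk w01 w_noninc, folded W_def]
  have J: "J_obj M f p w t (\<theta> k) = (\<integral>x. p t x * W x \<partial>M)" if "t \<in> \<Theta>" for t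
    unfolding W_def by (rule J_obj_eq_integral[OF p_dens[OF that] W(1)[unfolded W_def]])
  have Jk: "J_obj M f p w (\<theta> k) (\<theta> k) = Z_weight w"
    by (rule J_obj_self[where p = p, OF f_meas pk w01 w_noninc])
  have target: "target_density M f p w (\<theta> k) = (\<lambda>x. 1 / Z_weight w * W x * p (\<theta> k) x)"
    by (simp add: target_density_def W_def fun_eq_iff)
  have ge: "exp \<Delta> * Z_weight w \<le> J_obj M f p w (\<theta> (Suc k)) (\<theta> k)"
    unfolding J[OF theta_Suc_k]
  \<comment> \<open>The bound \<open>B\<close> is \<open>w 0\<close>. The remaining identity for
    \<open>Z_weight w\<close> is the self-objective written as an integral against the base
    measure.\<close>
  proof (rule KL_decrease_imp_integral_ge[OF W _ _ _ _ _ Z_pos target KL_step])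
    show "Z_weight w = (\<integral>x. p (\<theta> k) x * W x \<partial>M)"
      using J[OF theta_k] Jk by simp
  qed (simp_all add: prob_densityD[OF pk] prob_densityD[OF pS])
  moreover have "Z_weight w < exp \<Delta> * Z_weight w" if "0 < \<Delta>"
    using that Z_pos by simp
  ultimately show ?thesis
    unfolding Jk by force
qed

end
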